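(* Let $U_{n,m}$ be a uni-cyclic graph (a finite simple connected graph on $n$ vertices containing exactly one cycle, which has length $m\le n$), with edge set $E=\{e_1,e_2,\ldots,e_n\}$ labeled so that $\{e_1,\ldots,e_m\}$ is the edge set of the unique cycle. Then the spanning simplicial complex $\Delta_s(U_{n,m})$, regarded as a simplicial complex on $[n]$ by identifying $e_i$ with $i$, is shifted.
   Context: A spanning tree of a finite simple connected graph $G(V,E)$ is a subtree of $G$ containing every vertex of $G$; $s(G)$ is the collection of all edge sets of spanning trees of $G$. The spanning simplicial complex $\Delta_s(G)$ is the simplicial complex on the vertex set $E$ (the edges of $G$) whose facets are precisely the elements of $s(G)$. A uni-cyclic graph $U_{n,m}$ has exactly $n$ edges. A simplicial complex $\Delta$ on $[n]=\{1,\ldots,n\}$ is shifted if, for every $F\in\Delta$, every $i\in F$ and every $j\in[n]$ with $j>i$, one has $(F\setminus\{i\})\cup\{j\}\in\Delta$. *)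

theory Defs
  imports Main
begin

definition simple_graph :: "'a set \<Rightarrow> 'a set set \<Rightarrow> bool" where
  "simple_graph V E \<longleftrightarrow> finite V \<and> (\<forall>e\<in>E. e \<subseteq> V \<and> card e = 2)"

definition walk :: "'a set \<Rightarrow> 'a set set \<Rightarrow> 'a list \<Rightarrow> bool" where
  "walk V E p \<longleftrightarrow> p \<noteq> [] \<and> set p \<subseteq> V \<and> successively (\<lambda>x y. {x, y} \<in> E) p"

definition connected_graph :: "'a set \<Rightarrow> 'a set set \<Rightarrow> bool" where
  "connected_graph V E \<longleftrightarrow>
     V \<noteq> {} \<and> (\<forall>u\<in>V. \<forall>v\<in>V. \<exists>p. walk V E p \<and> hd p = u \<and> last p = v)"

text \<open>The edges of the closed walk \<open>p\<^sub>0, p\<^sub>1, \<dots>, p\<^sub>k\<^sub>-\<^sub>1, p\<^sub>0\<close>, where \<open>k\<close> is the length of the list \<open>p\<close>.\<close>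

definition closed_walk_edges :: "'a list \<Rightarrow> 'a set set" where
  "closed_walk_edges p = {{p ! i, p ! (Suc i mod length p)} | i. i < length p}"

definition is_cycle :: "'a set \<Rightarrow> 'a set set \<Rightarrow> 'a list \<Rightarrow> bool" where
  "is_cycle V E p \<longleftrightarrow>
     3 \<le> length p \<and> distinct p \<and> set p \<subseteq> V \<and> closed_walk_edges p \<subseteq> E"

text \<open>The cycles of a graph as subgraphs: a cycle is determined by its edge set, whereas the same
  cycle is traversed by several vertex lists (rotations and reversals). The length of a cycle is the
  cardinality of its edge set.\<close>

definition cycle_edge_sets :: "'a set \<Rightarrow> 'a set set \<Rightarrow> 'a set set set" where
  "cycle_edge_sets V E = {closed_walk_edges p | p. is_cycle V E p}"

definition unicyclic_graph :: "'a set \<Rightarrow> 'a set set \<Rightarrow> nat \<Rightarrow> nat \<Rightarrow> bool" where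
  "unicyclic_graph V E n m \<longleftrightarrow>
     simple_graph V E \<and> connected_graph V E \<and> card V = n \<and>
     (\<exists>!C. C \<in> cycle_edge_sets V E) \<and> (\<forall>C\<in>cycle_edge_sets V E. card C = m) \<and> m \<le> n"

definition tree :: "'a set \<Rightarrow> 'a set set \<Rightarrow> bool" where
  "tree V E \<longleftrightarrow> simple_graph V E \<and> connected_graph V E \<and> cycle_edge_sets V E = {}"

definition spanning_tree_edge_sets :: "'a set \<Rightarrow> 'a set set \<Rightarrow> 'a set set set" where
  "spanning_tree_edge_sets V E = {T. T \<subseteq> E \<and> tree V T}"

definition simplicial_complex_on :: "'b set \<Rightarrow> 'b set set \<Rightarrow> bool" where
  "simplicial_complex_on X \<Delta> \<longleftrightarrow>
     finite X \<and> \<Delta> \<subseteq> Pow X \<and> {} \<in> \<Delta> \<and> (\<forall>x\<in>X. {x} \<in> \<Delta>) \<and> (\<forall>F\<in>\<Delta>. \<forall>G. G \<subseteq> F \<longrightarrow> G \<in> \<Delta>)"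

definition facets :: "'b set set \<Rightarrow> 'b set set" where
  "facets \<Delta> = {F\<in>\<Delta>. \<forall>G\<in>\<Delta>. F \<subseteq> G \<longrightarrow> G = F}"

text \<open>That the facets of this complex are precisely the edge sets of spanning trees is
  \<open>facets_spanning_complex\<close> below.\<close>

definition spanning_complex :: "'a set \<Rightarrow> 'a set set \<Rightarrow> 'a set set set" where
  "spanning_complex V E = {F. \<exists>T\<in>spanning_tree_edge_sets V E. F \<subseteq> T}"

text \<open>Identification of the labelled ground element \<open>e i\<close> with \<open>i\<close>, for \<open>i\<close> in \<open>{1..n}\<close>.\<close>

definition index_complex :: "(nat \<Rightarrow> 'b) \<Rightarrow> nat \<Rightarrow> 'b set set \<Rightarrow> nat set set" where
  "index_complex e n \<Delta> = {I. I \<subseteq> {1..n} \<and> e ` I \<in> \<Delta>}"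

definition shifted_complex :: "nat \<Rightarrow> nat set set \<Rightarrow> bool" where
  "shifted_complex n \<Delta> \<longleftrightarrow>
     simplicial_complex_on {1..n} \<Delta> \<and>
     (\<forall>F\<in>\<Delta>. \<forall>i\<in>F. \<forall>j\<in>{1..n}. i < j \<longrightarrow> (F - {i}) \<union> {j} \<in> \<Delta>)"

lemma walk_imp_distinct_walk:
  assumes "walk V E p"
  shows "\<exists>q. walk V E q \<and> distinct q \<and> hd q = hd p \<and> last q = last p"
  using assms
proof (induction p rule: length_induct)
  case (1 p)
  show ?case
  proof (cases "distinct p")
    case True
    then show ?thesis using 1 by blast
  next
    case False
    then obtain xs ys zs y where p: "p = xs @ [y] @ ys @ [y] @ zs"
      using not_distinct_decomp by blast
    let ?q = "xs @ [y] @ zs"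
    have "walk V E ?q"
      using "1.prems" unfolding p walk_def
      by (auto simp: successively_append_iff successively_Cons split: if_splits)
    moreover have "length ?q < length p" by (simp add: p)
    moreover have "hd ?q = hd p" by (cases xs) (auto simp: p)
    moreover have "last ?q = last p" by (simp add: p)
    ultimately show ?thesis using "1.IH" by metis
  qed
qed

lemma tree_edges_antichain:
  assumes S: "tree V S" and T: "tree V T" and sub: "S \<subseteq> T"
  shows "S = T"
proof (rule ccontr)
  assume "S \<noteq> T"
  then obtain e where e: "e \<in> T" "e \<notin> S" using sub by blast
  then obtain u v where uv: "e = {u, v}" "u \<noteq> v" "u \<in> V" "v \<in> V"
    using T unfolding tree_def simple_graph_def by (metis card_2_iff insert_subset)
  then obtain q where q: "walk V S q" "distinct q" "hd q = u" "last q = v"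
    using S walk_imp_distinct_walk unfolding tree_def connected_graph_def by metis
  have len: "3 \<le> length q"
  proof (rule ccontr)
    assume "\<not> 3 \<le> length q"
    then have "length q = 0 \<or> length q = 1 \<or> length q = 2" by linarith
    then show False
      using q uv e by (auto simp: walk_def length_Suc_conv numeral_2_eq_2)
  qed
  have "closed_walk_edges q \<subseteq> T"
  proof
    fix f assume "f \<in> closed_walk_edges q"
    then obtain i where i: "i < length q" "f = {q ! i, q ! (Suc i mod length q)}"
      unfolding closed_walk_edges_def by blast
    show "f \<in> T"
    proof (cases "Suc i < length q")
      case True
      then have "f \<in> S"
        using i q(1) by (simp add: walk_def successively_conv_nth)
      then show ?thesis using sub by blast
    next
      case False
      then have L: "length q = Suc i" using i by simp
      then have "q \<noteq> []" by auto
      then have "f = {last q, hd q}"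
        using i(2) L by (simp add: last_conv_nth hd_conv_nth)
      then show ?thesis using q e uv by (simp add: insert_commute)
    qed
  qed
  then have "is_cycle V T q"
    using len q unfolding is_cycle_def walk_def by blast
  then show False using T unfolding tree_def cycle_edge_sets_def by blast
qed

lemma facets_spanning_complex:
  "facets (spanning_complex V E) = spanning_tree_edge_sets V E"
proof (intro equalityI subsetI)
  fix F assume "F \<in> facets (spanning_complex V E)"
  then show "F \<in> spanning_tree_edge_sets V E"
    unfolding facets_def spanning_complex_def by auto
next
  fix F assume F: "F \<in> spanning_tree_edge_sets V E"
  have "G = F" if "G \<in> spanning_complex V E" "F \<subseteq> G" for G
  proof -
    obtain T where T: "T \<in> spanning_tree_edge_sets V E" "G \<subseteq> T"
      using \<open>G \<in> spanning_complex V E\<close> unfolding spanning_complex_def by blast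
    then have "F = T"
      using F \<open>F \<subseteq> G\<close> tree_edges_antichain[of V F T] unfolding spanning_tree_edge_sets_def by blast
    then show ?thesis using T \<open>F \<subseteq> G\<close> by blast
  qed
  then show "F \<in> facets (spanning_complex V E)"
    using F unfolding facets_def spanning_complex_def by auto
qed

end

theory Submission
  imports Defs
begin

text \<open>Deleting one edge of the cycle leaves the graph connected and destroys its only cycle, and a
  spanning tree must omit some edge of the cycle. Hence the faces of the spanning complex are
  exactly the edge sets omitting an edge \<open>e k\<close> with \<open>k \<le> m\<close>. If \<open>F\<close> omits \<open>k\<close> and \<open>i \<in> F\<close> is
  exchanged for \<open>j > i\<close>, then \<open>k\<close> is still omitted unless \<open>j = k\<close>, in which case \<open>i < k \<le> m\<close> is
  omitted.\<close>

lemma walk_imp_rtrancl: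
  assumes "walk V E p"
  shows "(hd p, last p) \<in> {(x, y). {x, y} \<in> E}\<^sup>*"
  using assms
proof (induction p)
  case Nil
  then show ?case by (simp add: walk_def)
next
  case (Cons a p)
  show ?case
  proof (cases "p = []")
    case False
    with Cons.prems have "walk V E p" and "{a, hd p} \<in> E"
      by (auto simp: walk_def successively_Cons)
    with Cons.IH False show ?thesis
      by (auto intro: converse_rtrancl_into_rtrancl)
  qed simp
qed

lemma rtrancl_imp_walk:
  assumes "simple_graph V E" and "(u, v) \<in> {(x, y). {x, y} \<in> E}\<^sup>*" and "v \<in> V"
  shows "\<exists>p. walk V E p \<and> hd p = u \<and> last p = v"
  using assms(2)
proof (induction rule: converse_rtrancl_induct)
  case base
  have "walk V E [v]" using assms(3) by (simp add: walk_def)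
  then show ?case by force
next
  case (step x y)
  then obtain p where p: "walk V E p" "hd p = y" "last p = v" by blast
  have "{x, y} \<in> E" using step by simp
  moreover from this have "x \<in> V" using assms(1) by (auto simp: simple_graph_def)
  ultimately have "walk V E (x # p)" "last (x # p) = v"
    using p by (auto simp: walk_def successively_Cons)
  then show ?case by (metis list.sel(1))
qed

text \<open>Once connectedness is reachability in a closure, bypassing a deleted edge becomes an
  inclusion of closures, and no vertex lists have to be spliced.\<close>

lemma connected_graph_iff_rtrancl:
  assumes "simple_graph V E"
  shows "connected_graph V E \<longleftrightarrow>
    V \<noteq> {} \<and> (\<forall>u\<in>V. \<forall>v\<in>V. (u, v) \<in> {(x, y). {x, y} \<in> E}\<^sup>*)"
proof -
  have "(\<exists>p. walk V E p \<and> hd p = u \<and> last p = v) \<longleftrightarrow> (u, v) \<in> {(x, y). {x, y} \<in> E}\<^sup>*"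
    if "v \<in> V" for u v
  proof
    assume "\<exists>p. walk V E p \<and> hd p = u \<and> last p = v"
    then obtain p where "walk V E p" "hd p = u" "last p = v" by blast
    then show "(u, v) \<in> {(x, y). {x, y} \<in> E}\<^sup>*" using walk_imp_rtrancl[of V E p] by simp
  qed (rule rtrancl_imp_walk[OF assms _ that])
  then show ?thesis unfolding connected_graph_def by simp
qed

text \<open>Distinct indices with the same edge would be cyclic successors of each other, so two
  steps around the cycle would return to the start; length at least 3 excludes this.\<close>

lemma closed_walk_edge_eq_imp_index_eq:
  assumes "distinct p" "3 \<le> length p" "i < length p" "j < length p"
    and eq: "{p ! i, p ! (Suc i mod length p)} = {p ! j, p ! (Suc j mod length p)}"
  shows "i = j"
proof (rule ccontr)
  assume "i \<noteq> j"
  have "Suc i mod length p < length p" "Suc j mod length p < length p"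
    using assms(3,4) by (auto intro: mod_less_divisor)
  then have "i = Suc j mod length p" "j = Suc i mod length p"
    using eq \<open>i \<noteq> j\<close> assms(1,3,4) nth_eq_iff_index_eq[of p]
    unfolding doubleton_eq_iff by metis+
  then have "Suc j = length p \<and> i = 0 \<or> i = Suc j"
    "Suc i = length p \<and> j = 0 \<or> j = Suc i"
    using assms(3,4) by (metis mod_Suc mod_less)+
  then show False using assms(2) by (elim disjE conjE) linarith+
qed

text \<open>By the previous lemma a cycle has as many edges as its vertex list has entries. The
  bound 2 is what makes every single edge a face of the complex.\<close>

lemma two_le_card_cycle:
  assumes "C \<in> cycle_edge_sets V E"
  shows "2 \<le> card C"
proof -
  obtain p where p: "C = closed_walk_edges p" "is_cycle V E p"
    using assms unfolding cycle_edge_sets_def by blast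
  let ?f = "\<lambda>i. {p ! i, p ! (Suc i mod length p)}"
  have "C = ?f ` {..<length p}"
    unfolding p(1) closed_walk_edges_def by auto
  moreover have "inj_on ?f {..<length p}"
    using p(2) closed_walk_edge_eq_imp_index_eq[of p]
    by (intro inj_onI) (auto simp: is_cycle_def)
  ultimately have "card C = length p" by (simp add: card_image)
  then show ?thesis using p(2) by (simp add: is_cycle_def)
qed

lemma connected_graph_delete_cycle_edge:
  assumes "simple_graph V E" "connected_graph V E" "C \<in> cycle_edge_sets V E" "c \<in> C"
  shows "connected_graph V (E - {c})"
proof -
  let ?R = "{(x, y). {x, y} \<in> E - {c}}"
  obtain p where C: "C = closed_walk_edges p" and cyc: "is_cycle V E p"
    using assms(3) unfolding cycle_edge_sets_def by blast
  define k where "k = length p"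
  have k: "3 \<le> k" "distinct p" "closed_walk_edges p \<subseteq> E"
    using cyc by (auto simp: is_cycle_def k_def)
  obtain i where i: "i < k" and c: "c = {p ! i, p ! (Suc i mod k)}"
    using assms(4) unfolding C closed_walk_edges_def k_def by blast
  \<comment> \<open>The detour below runs in one direction only, while \<open>c\<close> may be read
    from either end.\<close>
  have sym: "sym (?R\<^sup>*)"
    by (intro sym_rtrancl) (auto simp: sym_def insert_commute)
  \<comment> \<open>Walk from one end of \<open>c\<close> to the other along the rest of the cycle.\<close>
  have along: "(p ! (Suc i mod k), p ! ((Suc i + t) mod k)) \<in> ?R\<^sup>*" if "t < k" for t
    using that
  proof (induction t)
    case (Suc t)
    define j where "j = (Suc i + t) mod k"
    have j: "j < k" using i by (simp add: j_def)
    \<comment> \<open>After \<open>t\<close> steps from \<open>Suc i\<close>, index \<open>i\<close>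
      is reached only for \<open>t = k - 1\<close>; here \<open>Suc t < k\<close>, so the edge
      leaving index \<open>j\<close> is not \<open>c\<close>.\<close>
    have "j \<noteq> i"
    proof (cases "Suc i + t < k")
      case True
      then show ?thesis by (simp add: j_def)
    next
      case False
      then have "j = Suc i + t - k"
        using i Suc.prems by (simp add: j_def mod_if)
      then show ?thesis using False Suc.prems by linarith
    qed
    then have "{p ! j, p ! (Suc j mod k)} \<noteq> c"
      using closed_walk_edge_eq_imp_index_eq[of p j i] k i j unfolding c k_def by blast
    moreover have "{p ! j, p ! (Suc j mod k)} \<in> E"
      using k(3) j unfolding closed_walk_edges_def k_def by blast
    moreover have "Suc j mod k = (Suc i + Suc t) mod k"
      by (simp add: j_def mod_Suc_eq)
    ultimately have "(p ! j, p ! ((Suc i + Suc t) mod k)) \<in> ?R" by simp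
    moreover have "(p ! (Suc i mod k), p ! j) \<in> ?R\<^sup>*"
      using Suc by (simp add: j_def)
    ultimately show ?case by (rule rtrancl_into_rtrancl[rotated])
  qed simp
  have "(Suc i + (k - 1)) mod k = i" using i by simp
  with along[of "k - 1"] i have ends: "(p ! (Suc i mod k), p ! i) \<in> ?R\<^sup>*" by simp
  have "(x, y) \<in> ?R\<^sup>*" if "{x, y} \<in> E" for x y
  proof (cases "{x, y} = c")
    case True
    then show ?thesis
      using ends symD[OF sym ends] unfolding c doubleton_eq_iff by blast
  next
    case False
    with that show ?thesis by blast
  qed
  then have "{(x, y). {x, y} \<in> E}\<^sup>* \<subseteq> ?R\<^sup>*"
    using rtrancl_subset_rtrancl[of "{(x, y). {x, y} \<in> E}" ?R] by blast
  moreover have "simple_graph V (E - {c})"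
    using assms(1) by (simp add: simple_graph_def)
  ultimately show ?thesis
    using assms(1,2) connected_graph_iff_rtrancl by blast
qed

lemma cycle_edge_sets_mono:
  "E' \<subseteq> E \<Longrightarrow> cycle_edge_sets V E' \<subseteq> cycle_edge_sets V E"
  by (fastforce simp: cycle_edge_sets_def is_cycle_def)

lemma cycle_edge_sets_subset:
  "C \<in> cycle_edge_sets V E \<Longrightarrow> C \<subseteq> E"
  by (auto simp: cycle_edge_sets_def is_cycle_def)

text \<open>Being a cycle depends on the edge set only through containing the edges of the closed
  walk, so the same vertex list serves for \<open>T\<close>.\<close>

lemma subset_in_cycle_edge_sets:
  "C \<in> cycle_edge_sets V E \<Longrightarrow> C \<subseteq> T \<Longrightarrow> C \<in> cycle_edge_sets V T"
  by (auto simp: cycle_edge_sets_def is_cycle_def)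

text \<open>A cycle that survives the deletion is a cycle of \<open>E\<close>, hence equals
  \<open>C\<close> by uniqueness; but \<open>C\<close> contains the deleted edge.\<close>

lemma unicyclic_delete_cycle_edge_tree:
  assumes "unicyclic_graph V E n m" "C \<in> cycle_edge_sets V E" "c \<in> C"
  shows "tree V (E - {c})"
proof -
  have "D \<notin> cycle_edge_sets V (E - {c})" for D
  proof
    assume D: "D \<in> cycle_edge_sets V (E - {c})"
    then have "D \<in> cycle_edge_sets V E" using cycle_edge_sets_mono[of "E - {c}" E V] by blast
    then have "D = C" using assms(1,2) unfolding unicyclic_graph_def by blast
    then show False using D assms(3) cycle_edge_sets_subset by blast
  qed
  moreover have "simple_graph V E" "connected_graph V E"
    using assms(1) by (simp_all add: unicyclic_graph_def)
  ultimately show ?thesis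
    using connected_graph_delete_cycle_edge[OF _ _ assms(2,3)]
    by (auto simp: tree_def simple_graph_def)
qed

lemma unicyclic_spanning_complex_iff:
  assumes "unicyclic_graph V E n m" "C \<in> cycle_edge_sets V E"
  shows "F \<in> spanning_complex V E \<longleftrightarrow> F \<subseteq> E \<and> \<not> C \<subseteq> F"
proof
  assume "F \<in> spanning_complex V E"
  then obtain T where T: "F \<subseteq> T" "T \<subseteq> E" "tree V T"
    unfolding spanning_complex_def spanning_tree_edge_sets_def by blast
  then have "\<not> C \<subseteq> T"
    using subset_in_cycle_edge_sets[OF assms(2)] unfolding tree_def by blast
  with T show "F \<subseteq> E \<and> \<not> C \<subseteq> F" by blast
next
  assume "F \<subseteq> E \<and> \<not> C \<subseteq> F"
  then obtain c where "c \<in> C" "F \<subseteq> E - {c}" by blast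
  then show "F \<in> spanning_complex V E"
    using unicyclic_delete_cycle_edge_tree[OF assms]
    unfolding spanning_complex_def spanning_tree_edge_sets_def by blast
qed

theorem theorem3p8:
  fixes V :: "'a set" and E :: "'a set set" and e :: "nat \<Rightarrow> 'a set" and n m :: nat
  assumes "unicyclic_graph V E n m"
    and "bij_betw e {1..n} E"
    and "e ` {1..m} \<in> cycle_edge_sets V E"
  shows "shifted_complex n (index_complex e n (spanning_complex V E))"
proof -
  let ?\<Delta> = "index_complex e n (spanning_complex V E)"
  have "m \<le> n" using assms(1) by (simp add: unicyclic_graph_def)
  have "m = card (e ` {1..m})"
    using assms(1,3) by (auto simp: unicyclic_graph_def)
  then have "2 \<le> m" using two_le_card_cycle[OF assms(3)] by simp
  have inj: "inj_on e {1..n}" and im: "e ` {1..n} = E"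
    using assms(2) by (auto simp: bij_betw_def)
  have face: "I \<in> ?\<Delta> \<longleftrightarrow> I \<subseteq> {1..n} \<and> \<not> {1..m} \<subseteq> I" for I
  proof -
    \<comment> \<open>Injectivity of \<open>e\<close> on \<open>{1..n}\<close> pulls the inclusion
      back to indices; \<open>m \<le> n\<close> keeps \<open>{1..m}\<close> inside this
      domain.\<close>
    have "e ` {1..m} \<subseteq> e ` I \<longleftrightarrow> {1..m} \<subseteq> I" if "I \<subseteq> {1..n}"
      using inj_on_image_mem_iff[OF inj _ that] \<open>m \<le> n\<close> by (fastforce simp: subset_iff)
    then show ?thesis
      unfolding index_complex_def unicyclic_spanning_complex_iff[OF assms(1,3)]
      using im by blast
  qed
  \<comment> \<open>A cycle has more than one edge, so no singleton contains it and every element of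
    \<open>{1..n}\<close> is a vertex of the complex.\<close>
  have "\<not> {1..m} \<subseteq> {x}" for x
    using \<open>2 \<le> m\<close> card_mono[of "{x}" "{1..m}"] by auto
  then have "{x} \<in> ?\<Delta>" if "x \<in> {1..n}" for x
    using that unfolding face by blast
  moreover have "{} \<in> ?\<Delta>" using \<open>2 \<le> m\<close> face by simp
  moreover have "G \<in> ?\<Delta>" if "F \<in> ?\<Delta>" "G \<subseteq> F" for F G
    using that unfolding face by blast
  moreover have "?\<Delta> \<subseteq> Pow {1..n}" by (intro subsetI) (simp add: face)
  ultimately have "simplicial_complex_on {1..n} ?\<Delta>"
    unfolding simplicial_complex_on_def by blast
  moreover have "(F - {i}) \<union> {j} \<in> ?\<Delta>" if "F \<in> ?\<Delta>" "i \<in> F" "j \<in> {1..n}" "i < j" for F i j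
  proof -
    obtain k where k: "k \<in> {1..m}" "k \<notin> F" and F: "F \<subseteq> {1..n}"
      using \<open>F \<in> ?\<Delta>\<close> unfolding face by blast
    \<comment> \<open>The witness is the cycle index still omitted after the exchange. If
      \<open>j = k\<close>, then \<open>i < k\<close> gives \<open>i \<le> m\<close>, and
      \<open>1 \<le> i\<close> comes from \<open>F \<subseteq> {1..n}\<close>.\<close>
    have "(if j = k then i else k) \<in> {1..m}" "(if j = k then i else k) \<notin> (F - {i}) \<union> {j}"
      using k F that by (auto split: if_splits)
    then show ?thesis using F that(3) unfolding face by blast
  qed
  ultimately show ?thesis unfolding shifted_complex_def by blast
qed

end
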